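(* Consider the constrained deterministic optimal control problem of minimizing $G(T)$ over complete trajectories $T\in C$, a base heuristic $R$, and the rollout algorithm, all as defined in the context. Assume that the base heuristic is sequentially improving and generates a feasible complete trajectory starting from the initial state $\tilde y_0=\tilde x_0$, i.e., $R(\tilde y_0)\in C$. Then for each $k=0,1,\ldots,N-1$, the set $U_k(\tilde y_k)$ is nonempty, and we have $$G\big(R(\tilde y_0)\big)\ge G\big(T_0(\tilde y_0,\tilde u_0)\big)\ge G\big(T_1(\tilde y_1,\tilde u_1)\big)\ge\cdots\ge G\big(T_{N-1}(\tilde y_{N-1},\tilde u_{N-1})\big)=G(\tilde y_N),$$ where $T_k(\tilde y_k,\tilde u_k)=\big(\tilde y_k,\tilde u_k,R(\tilde y_{k+1})\big)$. In particular, the final trajectory $\tilde y_N$ generated by the rollout algorithm is feasible (i.e., $\tilde y_N\in C$) and has no larger cost than the trajectory $R(\tilde y_0)$ generated by the base heuristic starting from the initial state.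
   Context: Problem. Let $N\ge 1$. For $k=0,\ldots,N-1$ there is a system equation $x_{k+1}=f_k(x_k,u_k)$, where the state $x_k$ takes values in some (possibly infinite) set, the control $u_k$ takes values in some finite set, and $f_k$ is a given function. The initial state $\tilde x_0$ is given. A complete trajectory is a sequence $T=(x_0,u_0,x_1,u_1,\ldots,u_{N-1},x_N)$ with $x_0=\tilde x_0$ and $x_{k+1}=f_k(x_k,u_k)$ for all $k=0,\ldots,N-1$. $G$ is a given real-valued cost function of complete trajectories and $C$ is a given set of complete trajectories (the constraint set); a complete trajectory is called feasible if it belongs to $C$. The problem is to minimize $G(T)$ over $T\in C$. Partial trajectories and base heuristic. For $k=0,\ldots,N$, a partial trajectory $y_k=(x_0,u_0,x_1,\ldots,u_{k-1},x_k)$ starts at the given initial state and satisfies the system equation (so $y_0=\tilde x_0$, and $y_N$ is a complete trajectory). A base heuristic is a map $R$ that assigns to every such partial trajectory $y_k$ a complementary partial trajectory $R(y_k)=(x_k,u_k,x_{k+1},u_{k+1},\ldots,u_{N-1},x_N)$ that starts at the last state $x_k$ of $y_k$ and satisfies $x_{t+1}=f_t(x_t,u_t)$ for $t=k,\ldots,N-1$; for $k=N$, $R(y_N)=(x_N)$. Denote by $y_k\cup R(y_k)$ the complete trajectory obtained by joining $y_k$ and $R(y_k)$ at their common state $x_k$; in particular $\tilde y_0\cup R(\tilde y_0)=R(\tilde y_0)$. For $k=0,\ldots,N-1$, a partial trajectory $y_k$ with last state $x_k$, and a control $u_k$, let $y_{k+1}=\big(y_k,u_k,f_k(x_k,u_k)\big)$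 and let $T_k(y_k,u_k)=\big(y_k,u_k,R(y_{k+1})\big)$ denote the complete trajectory $y_{k+1}\cup R(y_{k+1})$. Let $U_k(y_k)=\{u_k\mid T_k(y_k,u_k)\in C\}$. Sequential improvement. The base heuristic is sequentially improving if for every $k=0,\ldots,N-1$ and every partial trajectory $y_k$ for which $y_k\cup R(y_k)\in C$, the set $U_k(y_k)$ is nonempty, and $$G\big(y_k\cup R(y_k)\big)\ge\min_{u_k\in U_k(y_k)}G\big(T_k(y_k,u_k)\big).$$ Rollout algorithm. Starting from $\tilde y_0=\tilde x_0$, for $k=0,1,\ldots,N-1$ the algorithm selects (with arbitrary tie-breaking) $$\tilde u_k\in\arg\min_{u_k\in U_k(\tilde y_k)}G\big(T_k(\tilde y_k,u_k)\big),$$ and sets $\tilde x_{k+1}=f_k(\tilde x_k,\tilde u_k)$ and $\tilde y_{k+1}=(\tilde y_k,\tilde u_k,\tilde x_{k+1})$. *)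

theory Defs
  imports Complex_Main
begin

text \<open>
  Alternating sequences \<open>(x, u, x', u', \<dots>, x'')\<close> that start and end with a state. The time index of
  the first state is not stored; it is an argument of the predicates below.
\<close>

datatype ('x, 'u) traj = End 'x | Step 'x 'u "('x, 'u) traj"

fun first_state :: "('x, 'u) traj \<Rightarrow> 'x" where
  "first_state (End x) = x"
| "first_state (Step x u T) = x"

fun last_state :: "('x, 'u) traj \<Rightarrow> 'x" where
  "last_state (End x) = x"
| "last_state (Step x u T) = last_state T"

text \<open>
  Joining \<open>y \<union> S\<close> at a common state: the last state of \<open>y\<close> is replaced by \<open>S\<close>, so this is
  the intended operation when \<open>first_state S = last_state y\<close>.
\<close>

fun join :: "('x, 'u) traj \<Rightarrow> ('x, 'u) traj \<Rightarrow> ('x, 'u) traj" where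
  "join (End x) S = S"
| "join (Step x u T) S = Step x u (join T S)"

text \<open>
  \<open>trajectory X W f k m T\<close>: \<open>T = (x\<^sub>k, u\<^sub>k, x\<^sub>k\<^sub>+\<^sub>1, \<dots>, u\<^sub>m\<^sub>-\<^sub>1, x\<^sub>m)\<close> runs from time \<open>k\<close> to
  time \<open>m\<close>, with states in \<open>X t\<close>, controls in \<open>W t\<close>, and \<open>x\<^sub>t\<^sub>+\<^sub>1 = f t x\<^sub>t u\<^sub>t\<close>.
\<close>

fun trajectory ::
  "(nat \<Rightarrow> 'x set) \<Rightarrow> (nat \<Rightarrow> 'u set) \<Rightarrow> (nat \<Rightarrow> 'x \<Rightarrow> 'u \<Rightarrow> 'x) \<Rightarrow> nat \<Rightarrow> nat \<Rightarrow> ('x, 'u) traj \<Rightarrow> bool"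
  where
  "trajectory X W f k m (End x) \<longleftrightarrow> k = m \<and> x \<in> X k"
| "trajectory X W f k m (Step x u T) \<longleftrightarrow>
     x \<in> X k \<and> u \<in> W k \<and> first_state T = f k x u \<and> trajectory X W f (Suc k) m T"

text \<open>For \<open>k = N\<close> these are the complete trajectories.\<close>

definition partial_trajectory ::
  "(nat \<Rightarrow> 'x set) \<Rightarrow> (nat \<Rightarrow> 'u set) \<Rightarrow> (nat \<Rightarrow> 'x \<Rightarrow> 'u \<Rightarrow> 'x) \<Rightarrow> 'x \<Rightarrow> nat \<Rightarrow> ('x, 'u) traj \<Rightarrow> bool"
  where
  "partial_trajectory X W f x0 k y \<longleftrightarrow> first_state y = x0 \<and> trajectory X W f 0 k y"

definition base_heuristic ::
  "nat \<Rightarrow> (nat \<Rightarrow> 'x set) \<Rightarrow> (nat \<Rightarrow> 'u set) \<Rightarrow> (nat \<Rightarrow> 'x \<Rightarrow> 'u \<Rightarrow> 'x) \<Rightarrow> 'x \<Rightarrow>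
   (('x, 'u) traj \<Rightarrow> ('x, 'u) traj) \<Rightarrow> bool" where
  "base_heuristic N X W f x0 R \<longleftrightarrow>
     (\<forall>k\<le>N. \<forall>y. partial_trajectory X W f x0 k y \<longrightarrow>
        first_state (R y) = last_state y \<and> trajectory X W f k N (R y))"

definition extend ::
  "(nat \<Rightarrow> 'x \<Rightarrow> 'u \<Rightarrow> 'x) \<Rightarrow> nat \<Rightarrow> ('x, 'u) traj \<Rightarrow> 'u \<Rightarrow> ('x, 'u) traj" where
  "extend f k y u = join y (Step (last_state y) u (End (f k (last_state y) u)))"

text \<open>\<open>T\<^sub>k(y, u)\<close>\<close>

definition heuristic_completion ::
  "(nat \<Rightarrow> 'x \<Rightarrow> 'u \<Rightarrow> 'x) \<Rightarrow> (('x, 'u) traj \<Rightarrow> ('x, 'u) traj) \<Rightarrow> nat \<Rightarrow> ('x, 'u) traj \<Rightarrow> 'u \<Rightarrow> ('x, 'u) traj"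
  where
  "heuristic_completion f R k y u = join (extend f k y u) (R (extend f k y u))"

text \<open>\<open>U\<^sub>k(y)\<close>\<close>

definition feasible_controls ::
  "(nat \<Rightarrow> 'u set) \<Rightarrow> (nat \<Rightarrow> 'x \<Rightarrow> 'u \<Rightarrow> 'x) \<Rightarrow> ('x, 'u) traj set \<Rightarrow>
   (('x, 'u) traj \<Rightarrow> ('x, 'u) traj) \<Rightarrow> nat \<Rightarrow> ('x, 'u) traj \<Rightarrow> 'u set" where
  "feasible_controls W f C R k y = {u \<in> W k. heuristic_completion f R k y u \<in> C}"

definition sequentially_improving ::
  "nat \<Rightarrow> (nat \<Rightarrow> 'x set) \<Rightarrow> (nat \<Rightarrow> 'u set) \<Rightarrow> (nat \<Rightarrow> 'x \<Rightarrow> 'u \<Rightarrow> 'x) \<Rightarrow> 'x \<Rightarrow>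
   (('x, 'u) traj \<Rightarrow> real) \<Rightarrow> ('x, 'u) traj set \<Rightarrow> (('x, 'u) traj \<Rightarrow> ('x, 'u) traj) \<Rightarrow> bool" where
  "sequentially_improving N X W f x0 G C R \<longleftrightarrow>
     (\<forall>k<N. \<forall>y. partial_trajectory X W f x0 k y \<and> join y (R y) \<in> C \<longrightarrow>
        feasible_controls W f C R k y \<noteq> {} \<and>
        G (join y (R y)) \<ge>
          Min ((\<lambda>u. G (heuristic_completion f R k y u)) ` feasible_controls W f C R k y))"

text \<open>The partial trajectory obtained by applying the controls \<open>u 0, \<dots>, u (k - 1)\<close> from \<open>x0\<close>.\<close>

fun control_traj ::
  "(nat \<Rightarrow> 'x \<Rightarrow> 'u \<Rightarrow> 'x) \<Rightarrow> 'x \<Rightarrow> (nat \<Rightarrow> 'u) \<Rightarrow> nat \<Rightarrow> ('x, 'u) traj" where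
  "control_traj f x0 u 0 = End x0"
| "control_traj f x0 u (Suc k) = extend f k (control_traj f x0 u k) (u k)"

text \<open>
  The controls \<open>u 0, \<dots>, u (n - 1)\<close> are possible outcomes (ties broken arbitrarily) of the first \<open>n\<close>
  iterations of the rollout algorithm. Nothing is required of \<open>u k\<close> for \<open>k \<ge> n\<close>; in particular
  \<open>rollout_controls \<dots> n u\<close> does not presuppose that iteration \<open>n\<close> can be carried out.
\<close>

definition rollout_controls ::
  "(nat \<Rightarrow> 'u set) \<Rightarrow> (nat \<Rightarrow> 'x \<Rightarrow> 'u \<Rightarrow> 'x) \<Rightarrow> 'x \<Rightarrow> (('x, 'u) traj \<Rightarrow> real) \<Rightarrow>
   ('x, 'u) traj set \<Rightarrow> (('x, 'u) traj \<Rightarrow> ('x, 'u) traj) \<Rightarrow> nat \<Rightarrow> (nat \<Rightarrow> 'u) \<Rightarrow> bool" where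
  "rollout_controls W f x0 G C R n u \<longleftrightarrow>
     (\<forall>k<n. is_arg_min (\<lambda>v. G (heuristic_completion f R k (control_traj f x0 u k) v))
              (\<lambda>v. v \<in> feasible_controls W f C R k (control_traj f x0 u k)) (u k))"

end

theory Submission
  imports Defs
begin

text \<open>
  Write \<open>H k = y\<^sub>k \<union> R(y\<^sub>k)\<close> along the rollout path. Since \<open>T\<^sub>k(y\<^sub>k, u\<^sub>k) = H (k + 1)\<close>, feasibility of \<open>H k\<close>
  and sequential improvement give a nonempty control set, and the minimizing control makes
  \<open>H (k + 1)\<close> feasible with no larger cost. The claims follow from \<open>H 0 = R(y\<^sub>0)\<close> and \<open>H N = y\<^sub>N\<close>.
\<close>

lemma first_state_join:
  "first_state S = last_state y \<Longrightarrow> first_state (join y S) = first_state y"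
  by (cases y) auto

lemma join_End_last_state: "join y (End (last_state y)) = y"
  by (induction y) auto

lemma trajectory_le: "trajectory X W f k m T \<Longrightarrow> k \<le> m"
  by (induction T arbitrary: k) (auto dest: Suc_leD)

text \<open>Each \<open>Step\<close> advances the time by one, so a \<open>Step\<close> here would
  have a tail from \<open>Suc k\<close> to \<open>k\<close>, against
  \<open>trajectory_le\<close>.\<close>

lemma trajectory_same_time: "trajectory X W f k k T \<Longrightarrow> T = End (first_state T)"
  by (cases T) (auto dest: trajectory_le)

lemma last_state_in: "trajectory X W f k m T \<Longrightarrow> last_state T \<in> X m"
  by (induction T arbitrary: k) auto

text \<open>By \<open>first_state_join\<close>, joining \<open>S\<close> to the tail of a
  \<open>Step\<close> keeps the tail's first state, so the system equation at that
  \<open>Step\<close> survives.\<close>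

lemma trajectory_join:
  assumes "trajectory X W f k m y" "trajectory X W f m n S" "first_state S = last_state y"
  shows "trajectory X W f k n (join y S)"
  using assms by (induction y arbitrary: k) (auto simp: first_state_join)

lemma partial_trajectory_extend:
  assumes y: "partial_trajectory X W f x0 k y" and "u \<in> W k"
    and closed: "\<And>x. x \<in> X k \<Longrightarrow> f k x u \<in> X (Suc k)"
  shows "partial_trajectory X W f x0 (Suc k) (extend f k y u)"
proof -
  have "last_state y \<in> X k"
    using y by (auto simp: partial_trajectory_def dest: last_state_in)
  then show ?thesis
    using assms by (auto simp: partial_trajectory_def extend_def first_state_join intro!: trajectory_join)
qed

text \<open>At the horizon the heuristic's answer starts and ends at time \<open>N\<close>, so it is
  the single state \<open>last_state y\<close>, and joining it changes nothing.\<close>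

lemma join_base_heuristic_final:
  assumes "base_heuristic N X W f x0 R" "partial_trajectory X W f x0 N y"
  shows "join y (R y) = y"
proof -
  have "first_state (R y) = last_state y" "trajectory X W f N N (R y)"
    using assms by (auto simp: base_heuristic_def)
  then show ?thesis
    by (metis trajectory_same_time join_End_last_state)
qed

lemma rollout_controls_Suc:
  "rollout_controls W f x0 G C R (Suc n) u \<longleftrightarrow>
     rollout_controls W f x0 G C R n u \<and>
     is_arg_min (\<lambda>v. G (heuristic_completion f R n (control_traj f x0 u n) v))
       (\<lambda>v. v \<in> feasible_controls W f C R n (control_traj f x0 u n)) (u n)"
  by (auto simp: rollout_controls_def less_Suc_eq)

text \<open>A selected control lies in the feasible set, which says that its heuristic completion is
  in \<open>C\<close>; that completion is the join of the next rollout trajectory with its heuristic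
  continuation. Only the first \<open>n\<close> selections are assumed, so the invariant is
  available before control \<open>n\<close> is chosen.\<close>

lemma rollout_invariant:
  assumes dynamics: "\<And>k x u. k < N \<Longrightarrow> x \<in> X k \<Longrightarrow> u \<in> W k \<Longrightarrow> f k x u \<in> X (Suc k)"
    and "x0 \<in> X 0" and "R (End x0) \<in> C"
    and "n \<le> N" and "rollout_controls W f x0 G C R n u"
  shows "partial_trajectory X W f x0 n (control_traj f x0 u n) \<and>
    join (control_traj f x0 u n) (R (control_traj f x0 u n)) \<in> C"
  using assms(4,5)
proof (induction n)
  case 0
  then show ?case using assms(2,3) by (simp add: partial_trajectory_def)
next
  case (Suc n)
  let ?y = "control_traj f x0 u n"
  have "partial_trajectory X W f x0 n ?y"
    using Suc by (simp add: rollout_controls_Suc)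
  moreover have "u n \<in> feasible_controls W f C R n ?y"
    using Suc.prems by (simp add: rollout_controls_Suc is_arg_min_def)
  ultimately show ?case
    using Suc.prems(1) dynamics
    by (auto simp: feasible_controls_def heuristic_completion_def intro!: partial_trajectory_extend)
qed

text \<open>Links the selection rule of rollout, stated by \<open>is_arg_min\<close>, to the
  \<open>Min\<close> in sequential improvement. The minimizer itself lies in \<open>A\<close>, so
  \<open>Min\<close> is taken over a nonempty finite set.\<close>

lemma arg_min_le_Min:
  fixes g :: "'a \<Rightarrow> 'b::linorder"
  assumes "finite A" "is_arg_min g (\<lambda>v. v \<in> A) a"
  shows "g a \<le> Min (g ` A)"
  using assms by (subst Min_ge_iff) (auto simp: is_arg_min_linorder)

theorem proposition2p1:
  fixes N :: nat
    and X :: "nat \<Rightarrow> 'x set"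
    and W :: "nat \<Rightarrow> 'u set"
    and f :: "nat \<Rightarrow> 'x \<Rightarrow> 'u \<Rightarrow> 'x"
    and x0 :: 'x
    and G :: "('x, 'u) traj \<Rightarrow> real"
    and C :: "('x, 'u) traj set"
    and R :: "('x, 'u) traj \<Rightarrow> ('x, 'u) traj"
  assumes horizon: "N \<ge> 1"
    and finite_controls: "\<And>k. k < N \<Longrightarrow> finite (W k)"
    and dynamics: "\<And>k x u. k < N \<Longrightarrow> x \<in> X k \<Longrightarrow> u \<in> W k \<Longrightarrow> f k x u \<in> X (Suc k)"
    and initial: "x0 \<in> X 0"
    and constraint: "C \<subseteq> {T. partial_trajectory X W f x0 N T}"
    and heuristic: "base_heuristic N X W f x0 R"
    and improving: "sequentially_improving N X W f x0 G C R"
    and initially_feasible: "R (End x0) \<in> C"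
  shows "(\<forall>u. \<forall>k<N. rollout_controls W f x0 G C R k u \<longrightarrow>
            feasible_controls W f C R k (control_traj f x0 u k) \<noteq> {}) \<and>
         (\<forall>u. rollout_controls W f x0 G C R N u \<longrightarrow>
            (let y = control_traj f x0 u;
                 T = (\<lambda>k. heuristic_completion f R k (y k) (u k))
             in G (R (y 0)) \<ge> G (T 0) \<and>
                (\<forall>k. Suc k < N \<longrightarrow> G (T k) \<ge> G (T (Suc k))) \<and>
                G (T (N - 1)) = G (y N) \<and>
                y N \<in> C \<and>
                G (y N) \<le> G (R (y 0))))"
proof (intro conjI allI impI)
  fix u :: "nat \<Rightarrow> 'u" and k
  assume "k < N" and "rollout_controls W f x0 G C R k u"
  then show "feasible_controls W f C R k (control_traj f x0 u k) \<noteq> {}"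
    \<comment> \<open>The invariant at \<open>k\<close> makes the current join feasible, which is
      the premise of sequential improvement.\<close>
    using rollout_invariant[of N X W f x0 R C k G u] improving dynamics initial initially_feasible
    by (simp add: sequentially_improving_def)
next
  fix u :: "nat \<Rightarrow> 'u"
  assume rollout: "rollout_controls W f x0 G C R N u"
  define y where "y = control_traj f x0 u"
  define H where "H = (\<lambda>k. join (y k) (R (y k)))"
  have inv: "partial_trajectory X W f x0 k (y k) \<and> H k \<in> C" if "k \<le> N" for k
  proof -
    have "rollout_controls W f x0 G C R k u"
      using rollout that by (simp add: rollout_controls_def)
    then show ?thesis
      using rollout_invariant[of N X W f x0 R C k G u] dynamics initial initially_feasible that
      by (simp add: y_def H_def)
  qed
  have T: "heuristic_completion f R k (y k) (u k) = H (Suc k)" for k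
    by (simp add: H_def y_def heuristic_completion_def)
  have H_0: "H 0 = R (y 0)"
    by (simp add: H_def y_def)
  have H_N: "H N = y N"
    using join_base_heuristic_final[OF heuristic] inv[of N] by (simp add: H_def)
  have step: "G (H (Suc k)) \<le> G (H k)" if "k < N" for k
  proof -
    let ?U = "feasible_controls W f C R k (y k)"
    let ?g = "\<lambda>v. G (heuristic_completion f R k (y k) v)"
    \<comment> \<open>Finiteness, inherited from \<open>W k\<close>, makes \<open>Min\<close> a
      genuine minimum.\<close>
    have "finite ?U"
      using finite_controls[OF that] by (simp add: feasible_controls_def)
    moreover have "is_arg_min ?g (\<lambda>v. v \<in> ?U) (u k)"
      using rollout that by (simp add: rollout_controls_def y_def)
    ultimately have "?g (u k) \<le> Min (?g ` ?U)"
      by (rule arg_min_le_Min)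
    also have "\<dots> \<le> G (H k)"
      using improving inv[of k] that by (simp add: sequentially_improving_def H_def)
    finally show ?thesis
      by (simp add: T)
  qed
  have "G (H n) \<le> G (H 0)" if "n \<le> N" for n
    using that by (induction n) (auto intro: order_trans[OF step])
  then show "let y = control_traj f x0 u;
                 T = (\<lambda>k. heuristic_completion f R k (y k) (u k))
             in G (R (y 0)) \<ge> G (T 0) \<and>
                (\<forall>k. Suc k < N \<longrightarrow> G (T k) \<ge> G (T (Suc k))) \<and>
                G (T (N - 1)) = G (y N) \<and>
                y N \<in> C \<and>
                G (y N) \<le> G (R (y 0))"
    \<comment> \<open>In terms of \<open>H\<close> the indices shift by one: the first inequality is
      \<open>step\<close> at 0, the later ones are \<open>step\<close> at \<open>Suc k\<close>, and
      \<open>T (N - 1)\<close> is \<open>H N\<close> because \<open>N\<close> is at least 1.\<close>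
    unfolding Let_def y_def[symmetric]
    using step inv[of N] horizon by (auto simp: T simp flip: H_0 H_N)
qed

end
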